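(* Let $\mathfrak{g}$ be a real metric Lie algebra with no non-zero abelian factor and let $J:\mathfrak{g}\to\mathfrak{g}$ be an orthogonal bi-invariant complex structure. Suppose that the corresponding complex metric Lie algebra has an orthogonal decomposition $$(\mathfrak{g},J)=\bigoplus_{j=1}^k(\mathfrak{g}_j,J_j)$$ into irreducible factors $(\mathfrak{g}_j,J_j)$ (irreducible as complex metric Lie algebras), where $\mathfrak{g}_j\subset \mathfrak{g}$ is the underlying real Lie algebra of the $j$-th factor and $J_j=J|_{\mathfrak{g}_j}:\mathfrak{g}_j\to\mathfrak{g}_j$. Then every orthogonal bi-invariant complex structure on $\mathfrak{g}=\bigoplus_{j=1}^k\mathfrak{g}_j$ is of the form $\pm J_1\oplus\cdots\oplus\pm J_k$ for some choice of signs.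
   Context: All Lie algebras are finite-dimensional. A real (resp. complex) metric Lie algebra is a real (resp. complex) Lie algebra with a positive definite symmetric bilinear (resp. Hermitian, linear in the first argument) form, called the inner product. A factor is an ideal whose orthogonal complement is also an ideal; a non-zero metric Lie algebra is irreducible if its only factors are $0$ and itself. "No non-zero abelian factor" means that no non-zero factor is abelian. An orthogonal decomposition is an internal direct sum of pairwise orthogonal ideals. An orthogonal bi-invariant complex structure on a real metric Lie algebra $\mathfrak{g}$ is an $\mathbb{R}$-linear map $J:\mathfrak{g}\to\mathfrak{g}$ with $J^2=-\mathrm{Id}$, $J([X,Y])=[J(X),Y]$ and $\langle J(X),J(Y)\rangle=\langle X,Y\rangle$ for all $X,Y\in\mathfrak{g}$. Given such $J$, $(\mathfrak{g},J)$ denotes the complex Lie algebra with scalar multiplication $(a+bi)X=aX+bJ(X)$, equipped with the Hermitian inner product $\langle X,Y\rangle_{\mathbb{C}}=\tfrac12\left(\langle X,Y\rangle+i\langle X,JY\rangle\right)$. If $f_j:\mathfrak{g}_j\to\mathfrak{g}_j$ are linear maps, $f_1\oplus\cdots\oplus f_k$ is the unique linear map on $\bigoplus_j\mathfrak{g}_j$ extending all $f_j$. *)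

theory Defs
  imports "HOL-Analysis.Analysis"
begin

text \<open>
  Lie algebras, ideals and metric notions are stated over an arbitrary scalar multiplication
  \<open>smul\<close> (\<open>scaleR\<close> in the real case) and relative to a carrier \<open>V\<close> inside the ambient type,
  so that the same notions apply to a real metric Lie algebra, to the complex metric Lie algebra
  attached to a complex structure \<open>J\<close> on it, and to the summands of a decomposition. On a summand
  \<open>G j\<close> the complex operations given by \<open>J\<close> are those given by its restriction \<open>J|G j\<close>.
\<close>

definition lie_algebra ::
  "('k::field \<Rightarrow> 'a::ab_group_add \<Rightarrow> 'a) \<Rightarrow> ('a \<Rightarrow> 'a \<Rightarrow> 'a) \<Rightarrow> 'a set \<Rightarrow> bool" where
  "lie_algebra smul br V \<longleftrightarrow>
     vector_space smul \<and> module.subspace smul V \<and>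
     (\<exists>B. finite B \<and> module.span smul B = V) \<and>
     (\<forall>x\<in>V. \<forall>y\<in>V. br x y \<in> V) \<and>
     (\<forall>x\<in>V. \<forall>y\<in>V. \<forall>z\<in>V. br (x + y) z = br x z + br y z \<and> br x (y + z) = br x y + br x z) \<and>
     (\<forall>c. \<forall>x\<in>V. \<forall>y\<in>V. br (smul c x) y = smul c (br x y) \<and> br x (smul c y) = smul c (br x y)) \<and>
     (\<forall>x\<in>V. br x x = 0) \<and>
     (\<forall>x\<in>V. \<forall>y\<in>V. \<forall>z\<in>V. br x (br y z) + br y (br z x) + br z (br x y) = 0)"

definition lie_ideal ::
  "('k::field \<Rightarrow> 'a::ab_group_add \<Rightarrow> 'a) \<Rightarrow> ('a \<Rightarrow> 'a \<Rightarrow> 'a) \<Rightarrow> 'a set \<Rightarrow> 'a set \<Rightarrow> bool" where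
  "lie_ideal smul br V I \<longleftrightarrow>
     I \<subseteq> V \<and> module.subspace smul I \<and> (\<forall>x\<in>V. \<forall>y\<in>I. br x y \<in> I)"

definition lie_abelian :: "('a::ab_group_add \<Rightarrow> 'a \<Rightarrow> 'a) \<Rightarrow> 'a set \<Rightarrow> bool" where
  "lie_abelian br I \<longleftrightarrow> (\<forall>x\<in>I. \<forall>y\<in>I. br x y = 0)"

definition orth_complement :: "('a \<Rightarrow> 'a \<Rightarrow> 'k::zero) \<Rightarrow> 'a set \<Rightarrow> 'a set \<Rightarrow> 'a set" where
  "orth_complement form V I = {x \<in> V. \<forall>y\<in>I. form x y = 0}"

definition metric_factor ::
  "('k::field \<Rightarrow> 'a::ab_group_add \<Rightarrow> 'a) \<Rightarrow> ('a \<Rightarrow> 'a \<Rightarrow> 'a) \<Rightarrow> ('a \<Rightarrow> 'a \<Rightarrow> 'k) \<Rightarrow> 'a set \<Rightarrow> 'a set \<Rightarrow> bool"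
  where
  "metric_factor smul br form V I \<longleftrightarrow>
     lie_ideal smul br V I \<and> lie_ideal smul br V (orth_complement form V I)"

definition metric_irreducible ::
  "('k::field \<Rightarrow> 'a::ab_group_add \<Rightarrow> 'a) \<Rightarrow> ('a \<Rightarrow> 'a \<Rightarrow> 'a) \<Rightarrow> ('a \<Rightarrow> 'a \<Rightarrow> 'k) \<Rightarrow> 'a set \<Rightarrow> bool"
  where
  "metric_irreducible smul br form V \<longleftrightarrow>
     V \<noteq> {0} \<and> (\<forall>I. metric_factor smul br form V I \<longrightarrow> I = {0} \<or> I = V)"

definition internal_direct_sum :: "'a::ab_group_add set \<Rightarrow> 'i set \<Rightarrow> ('i \<Rightarrow> 'a set) \<Rightarrow> bool" where
  "internal_direct_sum V A G \<longleftrightarrow>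
     finite A \<and> (\<forall>j\<in>A. G j \<subseteq> V) \<and> (\<forall>x\<in>V. \<exists>!y. y \<in> (\<Pi>\<^sub>E j\<in>A. G j) \<and> x = (\<Sum>j\<in>A. y j))"

definition orthogonal_decomposition ::
  "('k::field \<Rightarrow> 'a::ab_group_add \<Rightarrow> 'a) \<Rightarrow> ('a \<Rightarrow> 'a \<Rightarrow> 'a) \<Rightarrow> ('a \<Rightarrow> 'a \<Rightarrow> 'k) \<Rightarrow> 'a set \<Rightarrow>
   'i set \<Rightarrow> ('i \<Rightarrow> 'a set) \<Rightarrow> bool" where
  "orthogonal_decomposition smul br form V A G \<longleftrightarrow>
     internal_direct_sum V A G \<and>
     (\<forall>j\<in>A. lie_ideal smul br V (G j)) \<and>
     (\<forall>i\<in>A. \<forall>j\<in>A. i \<noteq> j \<longrightarrow> (\<forall>x\<in>G i. \<forall>y\<in>G j. form x y = 0))"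

text \<open>
  A real metric Lie algebra is a bracket on a type of class \<open>real_inner\<close>, whose \<open>inner\<close> is the
  inner product; unlike \<open>euclidean_space\<close>, this class does not exclude the zero space.
\<close>

definition real_metric_lie_algebra :: "('a::real_inner \<Rightarrow> 'a \<Rightarrow> 'a) \<Rightarrow> bool" where
  "real_metric_lie_algebra br \<longleftrightarrow> lie_algebra scaleR br UNIV"

definition no_nonzero_abelian_factor :: "('a::real_inner \<Rightarrow> 'a \<Rightarrow> 'a) \<Rightarrow> bool" where
  "no_nonzero_abelian_factor br \<longleftrightarrow>
     (\<forall>I. metric_factor scaleR br inner UNIV I \<and> I \<noteq> {0} \<longrightarrow> \<not> lie_abelian br I)"

definition orth_biinv_complex_structure ::
  "('a::real_inner \<Rightarrow> 'a \<Rightarrow> 'a) \<Rightarrow> ('a \<Rightarrow> 'a) \<Rightarrow> bool" where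
  "orth_biinv_complex_structure br J \<longleftrightarrow>
     linear J \<and> (\<forall>x. J (J x) = - x) \<and> (\<forall>x y. J (br x y) = br (J x) y) \<and>
     (\<forall>x y. inner (J x) (J y) = inner x y)"

definition complex_scale :: "('a::real_inner \<Rightarrow> 'a) \<Rightarrow> complex \<Rightarrow> 'a \<Rightarrow> 'a" where
  "complex_scale J c x = Re c *\<^sub>R x + Im c *\<^sub>R J x"

definition complex_inner :: "('a::real_inner \<Rightarrow> 'a) \<Rightarrow> 'a \<Rightarrow> 'a \<Rightarrow> complex" where
  "complex_inner J x y = (1/2) * (complex_of_real (inner x y) + \<i> * complex_of_real (inner x (J y)))"

definition complex_metric_lie_algebra ::
  "(complex \<Rightarrow> 'a::ab_group_add \<Rightarrow> 'a) \<Rightarrow> ('a \<Rightarrow> 'a \<Rightarrow> 'a) \<Rightarrow> ('a \<Rightarrow> 'a \<Rightarrow> complex) \<Rightarrow> 'a set \<Rightarrow> bool"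
  where
  "complex_metric_lie_algebra smul br form V \<longleftrightarrow>
     lie_algebra smul br V \<and>
     (\<forall>x\<in>V. \<forall>y\<in>V. \<forall>z\<in>V. form (x + y) z = form x z + form y z) \<and>
     (\<forall>c. \<forall>x\<in>V. \<forall>y\<in>V. form (smul c x) y = c * form x y) \<and>
     (\<forall>x\<in>V. \<forall>y\<in>V. form y x = cnj (form x y)) \<and>
     (\<forall>x\<in>V. x \<noteq> 0 \<longrightarrow> 0 < Re (form x x))"

text \<open>
  Only the values of \<open>f j\<close> on \<open>G j\<close> matter. The description is meaningful when the ambient space
  is the internal direct sum of the subspaces \<open>G j\<close> and each \<open>f j\<close> is linear on \<open>G j\<close>; see
  \<open>direct_sum_map_unique\<close> below.
\<close>

definition direct_sum_map ::
  "'i set \<Rightarrow> ('i \<Rightarrow> 'a::real_vector set) \<Rightarrow> ('i \<Rightarrow> 'a \<Rightarrow> 'a) \<Rightarrow> 'a \<Rightarrow> 'a" where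
  "direct_sum_map A G f = (THE F. linear F \<and> (\<forall>j\<in>A. \<forall>x\<in>G j. F x = f j x))"

lemma complex_structure_linear:
  assumes "orth_biinv_complex_structure br J" shows "linear J"
  using assms by (simp add: orth_biinv_complex_structure_def)

lemma vector_space_complex_scale:
  assumes "orth_biinv_complex_structure br J"
  shows "vector_space (complex_scale J)"
proof -
  interpret J: linear J using complex_structure_linear[OF assms] .
  have JJ: "\<And>x. J (J x) = - x" using assms by (simp add: orth_biinv_complex_structure_def)
  show ?thesis
    by unfold_locales
      (simp_all add: complex_scale_def J.add J.scale JJ algebra_simps)
qed

lemma complex_metric_lie_algebra_of_structure:
  fixes br :: "'a::real_inner \<Rightarrow> 'a \<Rightarrow> 'a"
  assumes g: "real_metric_lie_algebra br" and J: "orth_biinv_complex_structure br J"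
  shows "complex_metric_lie_algebra (complex_scale J) br (complex_inner J) UNIV"
proof -
  interpret J: linear J using complex_structure_linear[OF J] .
  interpret V: vector_space "complex_scale J" using vector_space_complex_scale[OF J] .
  note L = g[unfolded real_metric_lie_algebra_def lie_algebra_def]
  have JJ: "\<And>x. J (J x) = - x" and Jb: "\<And>x y. br (J x) y = J (br x y)"
    and Ji: "\<And>x y. inner (J x) (J y) = inner x y"
    using J by (auto simp: orth_biinv_complex_structure_def)
  have add: "\<And>x y z. br (x + y) z = br x z + br y z" "\<And>x y z. br x (y + z) = br x y + br x z"
    and sc: "\<And>c x y. br (c *\<^sub>R x) y = c *\<^sub>R br x y" "\<And>c x y. br x (c *\<^sub>R y) = c *\<^sub>R br x y"
    and alt: "\<And>x. br x x = 0"
    using L by auto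
  have anti: "br x y = - br y x" for x y
    using alt[of "x + y"] alt[of x] alt[of y] by (simp add: add eq_neg_iff_add_eq_0 add.commute)
  have Jb2: "br x (J y) = J (br x y)" for x y
    using anti[of x "J y"] anti[of x y] by (simp add: Jb J.neg)
  have Ji2: "inner (J x) y = - inner x (J y)" for x y
    using Ji[of x "J y"] by (simp add: JJ)
  obtain B :: "'a set" where B: "finite B" "module.span scaleR B = UNIV" using L by blast
  have "module.span (complex_scale J) B = UNIV"
  proof -
    have "subspace (V.span B)"
    proof (rule subspaceI)
      fix c x assume "x \<in> V.span B"
      from V.span_scale[OF this, of "complex_of_real c"] show "c *\<^sub>R x \<in> V.span B"
        by (simp add: complex_scale_def)
    qed (auto intro: V.span_zero V.span_add)
    then have "span B \<subseteq> V.span B" by (intro span_minimal V.span_superset)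
    then show ?thesis using B by (simp add: span_raw_def top.extremum_unique)
  qed
  then have fd: "\<exists>B::'a set. finite B \<and> module.span (complex_scale J) B = UNIV" using B by blast
  have "lie_algebra (complex_scale J) br UNIV"
    unfolding lie_algebra_def
  proof (intro conjI)
    show "\<exists>B. finite B \<and> module.span (complex_scale J) B = UNIV" by (rule fd)
    show "\<forall>c. \<forall>x\<in>UNIV. \<forall>y\<in>UNIV. br (complex_scale J c x) y = complex_scale J c (br x y) \<and>
        br x (complex_scale J c y) = complex_scale J c (br x y)"
      by (simp add: complex_scale_def add sc Jb Jb2)
  qed (use L V.vector_space_axioms V.subspace_UNIV in blast)+
  moreover have "complex_inner J (x + y) z = complex_inner J x z + complex_inner J y z" for x y z
    by (simp add: complex_inner_def inner_add_left algebra_simps)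
  moreover have "complex_inner J (complex_scale J c x) y = c * complex_inner J x y" for c x y
    by (simp add: complex_eq_iff complex_inner_def complex_scale_def inner_add_left Ji Ji2 JJ
        algebra_simps)
  moreover have "complex_inner J y x = cnj (complex_inner J x y)" for x y
  proof -
    have "inner y (J x) = - inner x (J y)" using Ji2[of x y] inner_commute[of y "J x"] by linarith
    then show ?thesis
      by (simp add: complex_eq_iff complex_inner_def inner_commute[of y x])
  qed
  moreover have "0 < Re (complex_inner J x x)" if "x \<noteq> 0" for x
    using that by (simp add: complex_inner_def)
  ultimately show ?thesis unfolding complex_metric_lie_algebra_def by blast
qed

lemma direct_sum_map_unique:
  fixes G :: "'i \<Rightarrow> 'a::real_vector set"
  assumes ds: "internal_direct_sum UNIV A G" and sub: "\<And>j. j \<in> A \<Longrightarrow> subspace (G j)"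
    and fadd: "\<And>j x y. j \<in> A \<Longrightarrow> x \<in> G j \<Longrightarrow> y \<in> G j \<Longrightarrow> f j (x + y) = f j x + f j y"
    and fsc: "\<And>j c x. j \<in> A \<Longrightarrow> x \<in> G j \<Longrightarrow> f j (c *\<^sub>R x) = c *\<^sub>R f j x"
  shows "\<exists>!F. linear F \<and> (\<forall>j\<in>A. \<forall>x\<in>G j. F x = f j x)"
proof -
  have fin: "finite A" using ds by (simp add: internal_direct_sum_def)
  have "\<forall>x. \<exists>!y. y \<in> (\<Pi>\<^sub>E j\<in>A. G j) \<and> x = (\<Sum>j\<in>A. y j)"
    using ds by (simp add: internal_direct_sum_def)
  then obtain p where p: "\<And>x. p x \<in> (\<Pi>\<^sub>E j\<in>A. G j)" "\<And>x. x = (\<Sum>j\<in>A. p x j)"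
    and uniq: "\<And>x y. y \<in> (\<Pi>\<^sub>E j\<in>A. G j) \<Longrightarrow> x = (\<Sum>j\<in>A. y j) \<Longrightarrow> y = p x"
    by metis
  have pG: "p x j \<in> G j" if "j \<in> A" for x j using p(1)[of x] that by auto
  have comp: "p x j = y j" if "\<And>j. j \<in> A \<Longrightarrow> y j \<in> G j" "x = (\<Sum>j\<in>A. y j)" "j \<in> A" for x y j
  proof -
    have "restrict y A = p x" using that(1,2) by (intro uniq) auto
    then show ?thesis using that(3) by (metis restrict_apply')
  qed
  define F where "F x = (\<Sum>j\<in>A. f j (p x j))" for x
  have padd: "p (x + y) j = p x j + p y j" if "j \<in> A" for x y j
  proof (rule comp[OF _ _ that])
    show "x + y = (\<Sum>j\<in>A. p x j + p y j)"
      unfolding sum.distrib p(2)[symmetric] ..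
  qed (simp add: pG sub subspace_add)
  have psc: "p (c *\<^sub>R x) j = c *\<^sub>R p x j" if "j \<in> A" for c x j
  proof (rule comp[OF _ _ that])
    show "c *\<^sub>R x = (\<Sum>j\<in>A. c *\<^sub>R p x j)"
      unfolding scaleR_sum_right[symmetric] p(2)[symmetric] ..
  qed (simp add: pG sub subspace_scale)
  have "linear F"
    by (rule linearI)
      (simp_all add: F_def padd psc fadd fsc pG sum.distrib scaleR_sum_right)
  moreover have "F x = f j x" if j: "j \<in> A" "x \<in> G j" for j x
  proof -
    have "p x i = (if i = j then x else 0)" if "i \<in> A" for i
      by (rule comp[OF _ _ that]) (use j fin sub in \<open>auto intro: subspace_0\<close>)
    moreover have "f i 0 = 0" if "i \<in> A" for i
      using fsc[of i 0 0] sub[OF that] that by (simp add: subspace_0)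
    ultimately have "F x = (\<Sum>i\<in>A. if i = j then f j x else 0)"
      unfolding F_def by (intro sum.cong) auto
    then show ?thesis using fin j by simp
  qed
  moreover have "F' = F" if F': "linear F'" "\<forall>j\<in>A. \<forall>x\<in>G j. F' x = f j x" for F'
  proof
    fix x
    have "F' x = (\<Sum>j\<in>A. F' (p x j))"
      unfolding linear_sum[OF F'(1), symmetric] p(2)[symmetric] ..
    then show "F' x = F x" using F'(2) pG by (simp add: F_def)
  qed
  ultimately show ?thesis by blast
qed

end

theory Submission
  imports Defs
begin

text \<open>
  The key point is a rigidity property: on a real metric Lie algebra without non-zero abelian
  factor, any two bi-invariant operators that are symmetric or skew commute (\<open>bi_invariant_commute\<close>). Their
  commutator \<open>C\<close> vanishes on all brackets because each of the two operators may be moved to a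
  different slot of the bracket. Hence \<open>C\<close> has central values, and, being symmetric or skew itself,
  it has values orthogonal to \<open>[g, g]\<close>. But central vectors orthogonal to \<open>[g, g]\<close> form an abelian
  factor, which must vanish, so \<open>C = 0\<close>.

  An orthogonal bi-invariant complex structure is skew and bi-invariant, and so \<open>J\<close> and \<open>J'\<close>
  commute; the orthogonal projection onto a summand \<open>G j\<close> is symmetric and bi-invariant, and so
  \<open>J'\<close> preserves \<open>G j\<close>. Therefore \<open>S = J J'\<close> is a symmetric, bi-invariant, complex linear
  involution of \<open>G j\<close>. Its eigenspaces for \<open>1\<close> and \<open>-1\<close> are complementary orthogonal complex
  ideals of \<open>G j\<close>, and irreducibility forces one of them to be all of \<open>G j\<close>
  (\<open>involution_scalar_on_irreducible\<close>). That is, \<open>J' = \<mp>J\<close> on \<open>G j\<close>.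
\<close>

section \<open>Bi-invariant operators commute\<close>

definition bi_invariant :: "('a::real_inner \<Rightarrow> 'a \<Rightarrow> 'a) \<Rightarrow> ('a \<Rightarrow> 'a) \<Rightarrow> bool" where
  "bi_invariant br A \<longleftrightarrow> linear A \<and> (\<forall>x y. A (br x y) = br (A x) y)"

lemma real_metric_lie_algebraD:
  assumes "real_metric_lie_algebra br"
  shows "br (x + y) z = br x z + br y z" and "br x (y + z) = br x y + br x z"
    and "br (c *\<^sub>R x) y = c *\<^sub>R br x y" and "br x (c *\<^sub>R y) = c *\<^sub>R br x y"
    and "br x x = 0"
  using assms unfolding real_metric_lie_algebra_def lie_algebra_def by auto

lemma bracket_antisym:
  assumes "real_metric_lie_algebra br"
  shows "br x y = - br y x"
proof -
  note L = real_metric_lie_algebraD[OF assms]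
  show ?thesis
    using L(5)[of "x + y"] L(5)[of x] L(5)[of y]
    by (simp add: L(1,2) eq_neg_iff_add_eq_0 add.commute)
qed

lemma linear_bracket:
  assumes "real_metric_lie_algebra br"
  shows "linear (\<lambda>x. br x y)" and "linear (br x)"
  using real_metric_lie_algebraD[OF assms] by (auto intro!: linearI)

lemma bi_invariant_right:
  assumes g: "real_metric_lie_algebra br" and A: "bi_invariant br A"
  shows "A (br x y) = br x (A y)"
proof -
  have "A (br x y) = - A (br y x)"
    using A bracket_antisym[OF g, of x y] by (simp add: bi_invariant_def linear_neg)
  also have "\<dots> = br x (A y)"
    using A bracket_antisym[OF g, of x "A y"] by (simp add: bi_invariant_def)
  finally show ?thesis .
qed

text \<open>
  The vectors in question form a subspace of the centre, hence an abelian ideal; its orthogonal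
  complement contains every bracket and is therefore an ideal as well.
\<close>

lemma central_orthogonal_to_brackets_zero:
  assumes g: "real_metric_lie_algebra br" and na: "no_nonzero_abelian_factor br"
    and central: "\<And>y. br z y = 0" and orth: "\<And>a b. inner z (br a b) = 0"
  shows "z = 0"
proof -
  note L = real_metric_lie_algebraD[OF g]
  define I where "I = {z. (\<forall>y. br z y = 0) \<and> (\<forall>a b. inner z (br a b) = 0)}"
  have br0: "br y x = 0" if "x \<in> I" for x y
    using that bracket_antisym[OF g, of y x] by (simp add: I_def)
  have sub: "subspace I"
  proof (rule subspaceI)
    show "0 \<in> I" using linear_0[OF linear_bracket(1)[OF g]] by (simp add: I_def)
  qed (auto simp: I_def L inner_add_left)
  have "lie_ideal scaleR br UNIV I"
    unfolding lie_ideal_def using sub br0 by (auto simp: subspace_raw_def subspace_0)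
  moreover have "lie_ideal scaleR br UNIV (orth_complement inner UNIV I)"
    unfolding lie_ideal_def
  proof (intro conjI ballI)
    show "module.subspace scaleR (orth_complement inner UNIV I)"
      unfolding subspace_raw_def[symmetric]
      by (rule subspaceI) (auto simp: orth_complement_def inner_add_left)
    show "br x y \<in> orth_complement inner UNIV I" for x y
      by (auto simp: orth_complement_def I_def inner_commute)
  qed simp
  ultimately have "metric_factor scaleR br inner UNIV I" by (simp add: metric_factor_def)
  moreover have "lie_abelian br I" using br0 by (simp add: lie_abelian_def)
  ultimately have "I = {0}" using na unfolding no_nonzero_abelian_factor_def by blast
  moreover have "z \<in> I" using central orth by (simp add: I_def)
  ultimately show ?thesis by simp
qed

text \<open>
  The factors \<open>a\<close> and \<open>b\<close> are \<open>1\<close> for symmetric and \<open>-1\<close> for skew operators; the commutator \<open>C\<close>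
  then satisfies \<open>\<langle>C x, y\<rangle> = - a b \<langle>x, C y\<rangle>\<close>.
\<close>

lemma bi_invariant_commute:
  assumes g: "real_metric_lie_algebra br" and na: "no_nonzero_abelian_factor br"
    and A: "bi_invariant br A" and adjA: "\<And>x y. inner (A x) y = a * inner x (A y)"
    and B: "bi_invariant br B" and adjB: "\<And>x y. inner (B x) y = b * inner x (B y)"
  shows "A (B x) = B (A x)"
proof -
  have left: "A (br x y) = br (A x) y" "B (br x y) = br (B x) y" for x y
    using A B by (simp_all add: bi_invariant_def)
  note right = bi_invariant_right[OF g A] bi_invariant_right[OF g B]
  have AB: "A (B (br x y)) = B (A (br x y))" for x y
  proof -
    have "A (B (br x y)) = br (B x) (A y)" by (simp only: left(2) right(1))
    also have "\<dots> = B (A (br x y))" by (simp only: left(2) right(1))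
    finally show ?thesis .
  qed
  have "A (B x) - B (A x) = 0"
  proof (rule central_orthogonal_to_brackets_zero[OF g na])
    fix y
    have "br (A (B x) - B (A x)) y = br (A (B x)) y - br (B (A x)) y"
      by (rule linear_diff[OF linear_bracket(1)[OF g]])
    also have "\<dots> = 0" using AB[of x y] by (simp add: left)
    finally show "br (A (B x) - B (A x)) y = 0" .
  next
    fix c d
    show "inner (A (B x) - B (A x)) (br c d) = 0"
      using AB[of c d] by (simp add: inner_diff_left adjA adjB)
  qed
  then show ?thesis by simp
qed

section \<open>Complex structures and irreducible ideals\<close>

lemma complex_structure_bi_invariant:
  assumes "orth_biinv_complex_structure br J"
  shows "bi_invariant br J"
  using assms by (simp add: bi_invariant_def orth_biinv_complex_structure_def)

lemma complex_structure_skew: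
  assumes "orth_biinv_complex_structure br J"
  shows "inner (J x) y = - 1 * inner x (J y)"
proof -
  have "inner (J x) (J (J y)) = inner x (J y)"
    using assms unfolding orth_biinv_complex_structure_def by blast
  then show ?thesis using assms by (simp add: orth_biinv_complex_structure_def)
qed

lemma complex_subspace_iff:
  assumes "orth_biinv_complex_structure br J"
  shows "module.subspace (complex_scale J) V \<longleftrightarrow> subspace V \<and> (\<forall>x\<in>V. J x \<in> V)"
proof -
  interpret V: vector_space "complex_scale J" by (rule vector_space_complex_scale[OF assms])
  show ?thesis
  proof
    assume V: "V.subspace V"
    have "c *\<^sub>R x \<in> V" if "x \<in> V" for c x
      using V.subspace_scale[OF V that, of "complex_of_real c"] by (simp add: complex_scale_def)
    moreover have "J x \<in> V" if "x \<in> V" for x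
      using V.subspace_scale[OF V that, of \<i>] by (simp add: complex_scale_def)
    ultimately show "subspace V \<and> (\<forall>x\<in>V. J x \<in> V)"
      using V by (auto simp: V.subspace_def subspace_def)
  next
    assume V: "subspace V \<and> (\<forall>x\<in>V. J x \<in> V)"
    then have "complex_scale J c x \<in> V" if "x \<in> V" for c x
      using that by (simp add: complex_scale_def subspace_add subspace_scale)
    then show "V.subspace V" using V by (auto simp: V.subspace_def subspace_def)
  qed
qed

text \<open>
  Orthogonality for the Hermitian form is stronger than orthogonality for the real inner product,
  but on \<open>J\<close>-stable sets the two agree.
\<close>

lemma orth_complement_complex_inner:
  assumes "\<And>y. y \<in> I \<Longrightarrow> J y \<in> I"
  shows "orth_complement (complex_inner J) V I = orth_complement inner V I"
  using assms by (auto simp: orth_complement_def complex_inner_def complex_eq_iff)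

text \<open>
  The fixed space of \<open>S\<close> in \<open>V\<close> is a complex ideal whose orthogonal complement is the eigenspace
  for \<open>-1\<close>, so that it is a factor.
\<close>

lemma involution_scalar_on_irreducible:
  assumes g: "real_metric_lie_algebra br" and J: "orth_biinv_complex_structure br J"
    and V: "lie_ideal (complex_scale J) br UNIV V"
    and irr: "metric_irreducible (complex_scale J) br (complex_inner J) V"
    and S: "bi_invariant br S" and sym: "\<And>x y. inner (S x) y = inner x (S y)"
    and invol: "\<And>x. S (S x) = x" and SJ: "\<And>x. S (J x) = J (S x)"
    and SV: "\<And>x. x \<in> V \<Longrightarrow> S x \<in> V"
  shows "(\<forall>x\<in>V. S x = x) \<or> (\<forall>x\<in>V. S x = - x)"
proof -
  have lin: "linear S" using S by (simp add: bi_invariant_def)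
  have linJ: "linear J" by (rule complex_structure_linear[OF J])
  have subV: "subspace V" and JV: "\<And>x. x \<in> V \<Longrightarrow> J x \<in> V"
    and brV: "\<And>x y. y \<in> V \<Longrightarrow> br x y \<in> V"
    using V by (auto simp: lie_ideal_def complex_subspace_iff[OF J])
  define E where "E s = {x \<in> V. S x = s *\<^sub>R x}" for s :: real
  have ideal: "lie_ideal (complex_scale J) br V (E s)" for s
  proof -
    have "subspace (E s)"
      using subV
      by (auto simp: E_def subspace_def linear_0[OF lin] linear_add[OF lin]
          linear_scale[OF lin] algebra_simps)
    moreover have "J x \<in> E s" if "x \<in> E s" for x
      using that JV by (simp add: E_def SJ linear_scale[OF linJ])
    moreover have "br x y \<in> E s" if "y \<in> E s" for x y
      using that brV
      by (simp add: E_def bi_invariant_right[OF g S] real_metric_lie_algebraD(4)[OF g])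
    ultimately show ?thesis
      unfolding lie_ideal_def complex_subspace_iff[OF J] by (auto simp: E_def)
  qed
  have symmetrised: "x + S x \<in> E 1" if "x \<in> V" for x
    using that SV subV by (simp add: E_def subspace_add linear_add[OF lin] invol add.commute)
  have "orth_complement (complex_inner J) V (E 1) = orth_complement inner V (E 1)"
    using ideal[of 1] by (intro orth_complement_complex_inner)
      (simp add: lie_ideal_def complex_subspace_iff[OF J])
  also have "\<dots> = E (- 1)"
  proof (intro equalityI subsetI)
    fix x assume "x \<in> orth_complement inner V (E 1)"
    then have x: "x \<in> V" and "inner x (x + S x) = 0"
      using symmetrised by (auto simp: orth_complement_def)
    moreover have "inner (S x) (S x) = inner x x" by (simp add: sym invol)
    ultimately have "inner (x + S x) (x + S x) = 0"
      by (simp add: inner_add_left inner_add_right inner_commute)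
    then show "x \<in> E (- 1)" using x by (simp add: E_def eq_neg_iff_add_eq_0 add.commute)
  next
    fix x assume x: "x \<in> E (- 1)"
    have "inner x y = 0" if "y \<in> E 1" for y
      using sym[of x y] x that by (simp add: E_def)
    then show "x \<in> orth_complement inner V (E 1)"
      using x by (simp add: orth_complement_def E_def)
  qed
  finally have "metric_factor (complex_scale J) br (complex_inner J) V (E 1)"
    using ideal by (simp add: metric_factor_def)
  then have "E 1 = {0} \<or> E 1 = V" using irr by (simp add: metric_irreducible_def)
  then show ?thesis
  proof
    assume "E 1 = {0}"
    then have "x + S x = 0" if "x \<in> V" for x using symmetrised[OF that] by simp
    then show ?thesis by (auto simp: eq_neg_iff_add_eq_0 add.commute)
  next
    assume "E 1 = V"
    then show ?thesis by (auto simp: E_def)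
  qed
qed

section \<open>Orthogonal decompositions\<close>

text \<open>
  Bracketing acts on each summand separately, which makes the projection bi-invariant; the summands
  are pairwise orthogonal, which makes it symmetric.
\<close>

lemma summand_projection:
  assumes g: "real_metric_lie_algebra br"
    and dec: "orthogonal_decomposition scaleR br inner UNIV A G" and j: "j \<in> A"
  obtains p where "bi_invariant br p" and "\<And>x y. inner (p x) y = inner x (p y)"
    and "\<And>x. x \<in> G j \<Longrightarrow> p x = x" and "range p = G j"
proof -
  have ds: "internal_direct_sum UNIV A G" and fin: "finite A"
    and sub: "\<And>i. i \<in> A \<Longrightarrow> subspace (G i)"
    and brG: "\<And>i x y. i \<in> A \<Longrightarrow> y \<in> G i \<Longrightarrow> br x y \<in> G i"
    and orth: "\<And>i l x y. i \<in> A \<Longrightarrow> l \<in> A \<Longrightarrow> i \<noteq> l \<Longrightarrow> x \<in> G i \<Longrightarrow> y \<in> G l \<Longrightarrow> inner x y = 0"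
    using dec
    by (auto simp: orthogonal_decomposition_def internal_direct_sum_def lie_ideal_def
        subspace_raw_def)
  have brG': "br y x \<in> G i" if "i \<in> A" "y \<in> G i" for i x y
    using brG[OF that, of x] bracket_antisym[OF g, of y x] subspace_neg[OF sub[OF that(1)]] by simp
  have "\<exists>!p. linear p \<and> (\<forall>i\<in>A. \<forall>x\<in>G i. p x = (if i = j then x else 0))"
    by (rule direct_sum_map_unique[OF ds sub]) auto
  then obtain p where lin: "linear p"
    and p: "\<forall>i\<in>A. \<forall>x\<in>G i. p x = (if i = j then x else 0)"
    by blast
  have p_sum: "p (\<Sum>i\<in>A. c i) = c j" if "\<And>i. i \<in> A \<Longrightarrow> c i \<in> G i" for c
  proof -
    have "p (\<Sum>i\<in>A. c i) = (\<Sum>i\<in>A. if i = j then c j else 0)"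
      unfolding linear_sum[OF lin] by (intro sum.cong) (use p that in auto)
    then show ?thesis using fin j by simp
  qed
  have "\<exists>c. (\<forall>i\<in>A. c i \<in> G i) \<and> x = (\<Sum>i\<in>A. c i)" for x
  proof -
    obtain c where "c \<in> (\<Pi>\<^sub>E i\<in>A. G i)" "x = (\<Sum>i\<in>A. c i)"
      using ds unfolding internal_direct_sum_def by blast
    then show ?thesis by (intro exI[of _ c]) auto
  qed
  then obtain c where c: "\<And>x i. i \<in> A \<Longrightarrow> c x i \<in> G i" and c_sum: "\<And>x. x = (\<Sum>i\<in>A. c x i)"
    by metis
  have pc: "p x = c x j" for x using p_sum[of "c x"] c c_sum[of x] by simp
  have "p (br x y) = br (p x) y" for x y
  proof -
    have "br x y = (\<Sum>i\<in>A. br (c x i) y)"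
      using linear_sum[OF linear_bracket(1)[OF g], of "c x" A y] c_sum[of x] by simp
    then show ?thesis using p_sum[of "\<lambda>i. br (c x i) y"] brG' c by (simp add: pc)
  qed
  then have "bi_invariant br p" using lin by (simp add: bi_invariant_def)
  moreover have "inner (p x) y = inner x (p y)" for x y
  proof -
    have "inner (c x j) y = (\<Sum>i\<in>A. inner (c x j) (c y i))"
      by (subst c_sum[of y]) (rule inner_sum_right)
    also have "\<dots> = (\<Sum>i\<in>A. if i = j then inner (c x j) (c y j) else 0)"
      by (intro sum.cong) (use orth[OF j] c j in auto)
    also have "\<dots> = (\<Sum>i\<in>A. inner (c x i) (c y j))"
      by (intro sum.cong) (use orth[OF _ j] c j in auto)
    also have "\<dots> = inner x (c y j)"
      by (subst (2) c_sum[of x]) (rule inner_sum_left[symmetric])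
    finally show ?thesis by (simp add: pc)
  qed
  moreover have fixed: "p x = x" if "x \<in> G j" for x using p j that by auto
  moreover have "range p = G j"
  proof (intro equalityI subsetI)
    show "x \<in> range p" if "x \<in> G j" for x using fixed[OF that] by (metis rangeI)
  qed (use c[OF j] pc in auto)
  ultimately show thesis by (rule that)
qed

lemma orthogonal_decomposition_real:
  assumes J: "orth_biinv_complex_structure br J"
    and dec: "orthogonal_decomposition (complex_scale J) br (complex_inner J) V A G"
  shows "orthogonal_decomposition scaleR br inner V A G"
  using dec
  by (simp add: orthogonal_decomposition_def lie_ideal_def complex_subspace_iff[OF J]
      subspace_raw_def complex_inner_def complex_eq_iff)

lemma complex_structure_on_irreducible_summand:
  assumes g: "real_metric_lie_algebra br" and na: "no_nonzero_abelian_factor br"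
    and J: "orth_biinv_complex_structure br J" and J': "orth_biinv_complex_structure br J'"
    and dec: "orthogonal_decomposition (complex_scale J) br (complex_inner J) UNIV A G"
    and j: "j \<in> A" and irr: "metric_irreducible (complex_scale J) br (complex_inner J) (G j)"
  shows "(\<forall>x\<in>G j. J' x = J x) \<or> (\<forall>x\<in>G j. J' x = - J x)"
proof -
  note biJ = complex_structure_bi_invariant[OF J] and biJ' = complex_structure_bi_invariant[OF J']
  note skJ = complex_structure_skew[OF J] and skJ' = complex_structure_skew[OF J']
  have JJ: "J (J x) = - x" and JJ': "J' (J' x) = - x" for x
    using J J' by (simp_all add: orth_biinv_complex_structure_def)
  have linJ: "linear J" and linJ': "linear J'"
    using J J' by (simp_all add: complex_structure_linear)
  have comm: "J (J' x) = J' (J x)" for x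
    by (rule bi_invariant_commute[OF g na biJ skJ biJ' skJ'])
  have ideal: "lie_ideal (complex_scale J) br UNIV (G j)"
    using dec j by (simp add: orthogonal_decomposition_def)
  have JG: "J x \<in> G j" if "x \<in> G j" for x
    using ideal that by (simp add: lie_ideal_def complex_subspace_iff[OF J])
  obtain p where p: "bi_invariant br p" "\<And>x y. inner (p x) y = inner x (p y)"
    "\<And>x. x \<in> G j \<Longrightarrow> p x = x" "range p = G j"
    using summand_projection[OF g orthogonal_decomposition_real[OF J dec] j] by blast
  have J'G: "J' x \<in> G j" if "x \<in> G j" for x
  proof -
    have "p (J' x) = J' (p x)"
      by (rule bi_invariant_commute[OF g na p(1) _ biJ' skJ', of 1]) (simp add: p(2))
    then have "J' x = p (J' x)" using p(3)[OF that] by simp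
    then show ?thesis using p(4) by (metis rangeI)
  qed
  have "(\<forall>x\<in>G j. J (J' x) = x) \<or> (\<forall>x\<in>G j. J (J' x) = - x)"
  proof (rule involution_scalar_on_irreducible[OF g J ideal irr])
    show "bi_invariant br (\<lambda>x. J (J' x))"
      using biJ biJ' linear_compose[OF linJ' linJ] by (simp add: bi_invariant_def o_def)
    show "inner (J (J' x)) y = inner x (J (J' y))" for x y
      using skJ skJ' by (simp add: comm)
    show "J (J' (J (J' x))) = x" for x
      by (simp add: comm JJ JJ' linear_neg[OF linJ] linear_neg[OF linJ'])
  qed (use JG J'G comm in auto)
  moreover have "J' x = - J (J (J' x))" for x by (simp add: JJ)
  ultimately show ?thesis by (metis linear_neg[OF linJ] minus_minus)
qed

theorem theorem4p2:
  fixes br :: "'a::real_inner \<Rightarrow> 'a \<Rightarrow> 'a"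
    and J :: "'a \<Rightarrow> 'a"
    and k :: nat
    and G :: "nat \<Rightarrow> 'a set"
  assumes "real_metric_lie_algebra br"
    and "no_nonzero_abelian_factor br"
    and "orth_biinv_complex_structure br J"
    and "orthogonal_decomposition (complex_scale J) br (complex_inner J) UNIV {1..k} G"
    and "\<forall>j\<in>{1..k}. metric_irreducible (complex_scale J) br (complex_inner J) (G j)"
  shows "\<forall>J'. orth_biinv_complex_structure br J' \<longrightarrow>
    (\<exists>\<epsilon> :: nat \<Rightarrow> real. (\<forall>j\<in>{1..k}. \<epsilon> j = 1 \<or> \<epsilon> j = - 1) \<and>
       J' = direct_sum_map {1..k} G (\<lambda>j x. \<epsilon> j *\<^sub>R restrict J (G j) x))"
proof (intro allI impI)
  fix J' assume J': "orth_biinv_complex_structure br J'"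
  note dec = orthogonal_decomposition_real[OF assms(3,4)]
  have ds: "internal_direct_sum UNIV {1..k} G"
    and sub: "\<And>j. j \<in> {1..k} \<Longrightarrow> subspace (G j)"
    using dec by (auto simp: orthogonal_decomposition_def lie_ideal_def subspace_raw_def)
  have lin: "linear J" "linear J'" using assms(3) J' by (simp_all add: complex_structure_linear)
  define \<epsilon> :: "nat \<Rightarrow> real" where "\<epsilon> j = (if \<forall>x\<in>G j. J' x = J x then 1 else - 1)" for j
  define f where "f j x = \<epsilon> j *\<^sub>R restrict J (G j) x" for j x
  have J'f: "\<forall>j\<in>{1..k}. \<forall>x\<in>G j. J' x = f j x"
    using complex_structure_on_irreducible_summand[OF assms(1-3) J' assms(4)] assms(5)
    by (fastforce simp: f_def \<epsilon>_def)
  have "\<exists>!F. linear F \<and> (\<forall>j\<in>{1..k}. \<forall>x\<in>G j. F x = f j x)"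
    by (rule direct_sum_map_unique[OF ds sub])
      (auto simp: f_def subspace_add subspace_scale sub linear_add[OF lin(1)]
        linear_scale[OF lin(1)] algebra_simps)
  then have "direct_sum_map {1..k} G f = J'"
    unfolding direct_sum_map_def by (rule the1_equality) (use lin J'f in blast)
  moreover have "f = (\<lambda>j x. \<epsilon> j *\<^sub>R restrict J (G j) x)" by (simp add: f_def fun_eq_iff)
  ultimately show "\<exists>\<epsilon> :: nat \<Rightarrow> real. (\<forall>j\<in>{1..k}. \<epsilon> j = 1 \<or> \<epsilon> j = - 1) \<and>
       J' = direct_sum_map {1..k} G (\<lambda>j x. \<epsilon> j *\<^sub>R restrict J (G j) x)"
    by (intro exI[of _ \<epsilon>]) (auto simp: \<epsilon>_def)
qed

end
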